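(* Let $F_1\colon \mathbb{R}^n \rightrightarrows \mathbb{R}^p$ and $F_2 \colon \mathbb{R}^p \rightrightarrows \mathbb{R}^m$ be set-valued mappings with closed graphs, let $F := F_2 \circ F_1$, and let $\overline{y} \in J(F)$. Assume that both of the following conditions are satisfied. (a) (boundedness condition) There exist constants $R > 0$, $R' > 0$ and a neighborhood $V$ of $\overline{y}$ in $\mathbb{R}^m$ such that for all $x \in \mathbb{R}^n \setminus \mathbb{B}_R$ and $y \in V$ we have $$F_1(x) \cap F_2^{-1}(y) \subset \mathbb{B}_{R'}.$$ (b) (constraint qualification) For every $z \in J^\circ(F_2 \circ F_1, \overline{y})$ one has $$D^*F_2(z,\overline{y}) (0)\cap \mathrm{ker}\, D^*F_1(\infty , z) = \{0\}.$$ Then $\mathrm{gph}\,F$ is locally closed at $(\infty, \overline{y})$, and for all $v\in\mathbb{R}^m$ $$D^*(F_2 \circ F_1)(\infty, \overline{y})(v) \subset \bigcup_{\overline{z} \in J^\circ(F_2 \circ F_1, \overline{y})} \big( D^*F_1(\infty , \overline{z}) \circ D^*F_2(\overline{z} , \overline{y})\big)(v).$$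
   Context: All spaces $\mathbb{R}^n$ carry the Euclidean norm; $\mathbb{B}_r$ is the closed ball of radius $r$ centered at the origin. For $F\colon \mathbb{R}^n \rightrightarrows \mathbb{R}^m$: $\mathrm{gph}\,F := \{(x,y) : y\in F(x)\}$, $\mathrm{ker}\,F := \{x : 0\in F(x)\}$, $F^{-1}(y) := \{x : y\in F(x)\}$. Composition: $(F_2\circ F_1)(x) := \{y : F_1(x)\cap F_2^{-1}(y)\neq\emptyset\}$ (equivalently $\bigcup_{z\in F_1(x)}F_2(z)$); the same convention is used for composing coderivative mappings. Jelonek set: $J(F)$ is the set of $y\in\mathbb{R}^m$ for which there exist $(x_k,y_k)\in \mathrm{gph}\,F$ with $\|x_k\|\to\infty$ and $y_k\to y$. For $y\in\mathbb{R}^m$, $J^\circ(F_2\circ F_1,y)$ is the set of all $z\in\mathbb{R}^p$ for which there exist $x_k$ with $\|x_k\|\to\infty$, $z_k\in F_1(x_k)$ and $y_k\in F_2(z_k)$ with $z_k\to z$ and $y_k\to y$. Local closedness at infinity: a set $\Omega\subset\mathbb{R}^n\times\mathbb{R}^m$ is locally closed at $(\infty,\overline{y})$ if there are $R>0$ and a closed neighborhood $V$ of $\overline{y}$ such that $\{(x,y)\in\Omega : \|x\|\ge R,\ y\in V\}$ is closed. Normal cones: for $\Omega\subset\mathbb{R}^N$ and $z\in\Omega$, the regular normal cone $\widehat{N}_\Omega(z)$ is the set of $\xi$ with $\langle \xi, z'-z\rangle\le o(\|z'-z\|)$ as $z'\to z$, $z'\in\Omega$; the limiting normal cone $N_\Omega(z)$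 is the set of $\xi$ for which there exist $z_k\in\Omega$, $z_k\to z$, and $\xi_k\in\widehat{N}_\Omega(z_k)$ with $\xi_k\to\xi$. Normal cone at infinity: for $\Omega\subset\mathbb{R}^n\times\mathbb{R}^m$ and $\overline{y}\in\mathbb{R}^m$, $N_\Omega(\infty,\overline{y})$ is the set of all $\xi$ for which there exist $(x_k,y_k)\in\Omega$ with $\|x_k\|\to\infty$, $y_k\to\overline{y}$, and $\xi_k\in\widehat{N}_\Omega(x_k,y_k)$ with $\xi_k\to\xi$. Coderivatives: for $(\overline{x},\overline{y})\in\mathrm{gph}\,F$, $D^*F(\overline{x},\overline{y})(v) := \{u : (u,-v)\in N_{\mathrm{gph}\,F}(\overline{x},\overline{y})\}$; for $\overline{y}\in J(F)$, $D^*F(\infty,\overline{y})(v) := \{u : (u,-v)\in N_{\mathrm{gph}\,F}(\infty,\overline{y})\}$. *)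

theory Defs
  imports "HOL-Analysis.Analysis"
begin

(* A set-valued mapping from 'a to 'b is a function of type 'a => 'b set.  The product type
   carries the norm of HOL-Analysis, norm (x, y) = sqrt ((norm x)^2 + (norm y)^2), so it models
   the Euclidean space R^n x R^m. *)

definition gph :: "('a \<Rightarrow> 'b set) \<Rightarrow> ('a \<times> 'b) set" where
  "gph F = {(x, y). y \<in> F x}"

definition sv_ker :: "('a \<Rightarrow> 'b::zero set) \<Rightarrow> 'a set" where
  "sv_ker F = {x. 0 \<in> F x}"

definition sv_inv :: "('a \<Rightarrow> 'b set) \<Rightarrow> 'b \<Rightarrow> 'a set" where
  "sv_inv F y = {x. y \<in> F x}"

definition sv_comp :: "('b \<Rightarrow> 'c set) \<Rightarrow> ('a \<Rightarrow> 'b set) \<Rightarrow> 'a \<Rightarrow> 'c set"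
    (infixl "\<circ>\<^sub>s" 55) where
  "(F2 \<circ>\<^sub>s F1) x = {y. F1 x \<inter> sv_inv F2 y \<noteq> {}}"

definition jelonek_set ::
    "('a::real_normed_vector \<Rightarrow> 'b::real_normed_vector set) \<Rightarrow> 'b set" where
  "jelonek_set F = {y. \<exists>(x :: nat \<Rightarrow> 'a) (w :: nat \<Rightarrow> 'b).
     (\<forall>k. (x k, w k) \<in> gph F) \<and>
     filterlim (\<lambda>k. norm (x k)) at_top sequentially \<and> w \<longlonglongrightarrow> y}"

(* The set written J^o (F2 o F1, y).  It depends on the pair (F2, F1), not only on the composite
   mapping, hence the two separate arguments. *)
definition jelonek_comp_set ::
    "('b::real_normed_vector \<Rightarrow> 'c::real_normed_vector set) \<Rightarrow>
     ('a::real_normed_vector \<Rightarrow> 'b set) \<Rightarrow> 'c \<Rightarrow> 'b set" where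
  "jelonek_comp_set F2 F1 y = {z. \<exists>(x :: nat \<Rightarrow> 'a) (w :: nat \<Rightarrow> 'b) (u :: nat \<Rightarrow> 'c).
     filterlim (\<lambda>k. norm (x k)) at_top sequentially \<and>
     (\<forall>k. w k \<in> F1 (x k)) \<and> (\<forall>k. u k \<in> F2 (w k)) \<and>
     w \<longlonglongrightarrow> z \<and> u \<longlonglongrightarrow> y}"

definition locally_closed_at_infinity ::
    "('a::real_normed_vector \<times> 'b::real_normed_vector) set \<Rightarrow> 'b \<Rightarrow> bool" where
  "locally_closed_at_infinity \<Omega> y0 \<longleftrightarrow>
     (\<exists>R>0. \<exists>V. closed V \<and> y0 \<in> interior V \<and>
        closed {(x, y). (x, y) \<in> \<Omega> \<and> norm x \<ge> R \<and> y \<in> V})"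

(* The one-sided estimate inner xi (z' - z) <= o(norm (z' - z)) is written out with epsilon.
   The cones and coderivatives below are meant for base points in the set (resp. the graph, the
   Jelonek set); their values at other points carry no meaning. *)
definition regular_normal_cone :: "'a::real_inner set \<Rightarrow> 'a \<Rightarrow> 'a set" where
  "regular_normal_cone \<Omega> z = {\<xi>. \<forall>\<epsilon>>0.
     eventually (\<lambda>z'. inner \<xi> (z' - z) \<le> \<epsilon> * norm (z' - z)) (at z within \<Omega>)}"

definition limiting_normal_cone :: "'a::real_inner set \<Rightarrow> 'a \<Rightarrow> 'a set" where
  "limiting_normal_cone \<Omega> z = {\<xi>. \<exists>(w :: nat \<Rightarrow> 'a) (\<zeta> :: nat \<Rightarrow> 'a).
     (\<forall>k. w k \<in> \<Omega>) \<and> w \<longlonglongrightarrow> z \<and>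
     (\<forall>k. \<zeta> k \<in> regular_normal_cone \<Omega> (w k)) \<and> \<zeta> \<longlonglongrightarrow> \<xi>}"

definition normal_cone_at_infinity ::
    "('a::real_inner \<times> 'b::real_inner) set \<Rightarrow> 'b \<Rightarrow> ('a \<times> 'b) set" where
  "normal_cone_at_infinity \<Omega> y0 =
     {\<xi>. \<exists>(x :: nat \<Rightarrow> 'a) (y :: nat \<Rightarrow> 'b) (\<zeta> :: nat \<Rightarrow> 'a \<times> 'b).
       (\<forall>k. (x k, y k) \<in> \<Omega>) \<and>
       filterlim (\<lambda>k. norm (x k)) at_top sequentially \<and> y \<longlonglongrightarrow> y0 \<and>
       (\<forall>k. \<zeta> k \<in> regular_normal_cone \<Omega> (x k, y k)) \<and> \<zeta> \<longlonglongrightarrow> \<xi>}"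

definition coderivative ::
    "('a::real_inner \<Rightarrow> 'b::real_inner set) \<Rightarrow> 'a \<Rightarrow> 'b \<Rightarrow> 'b \<Rightarrow> 'a set" where
  "coderivative F x y v = {u. (u, - v) \<in> limiting_normal_cone (gph F) (x, y)}"

definition coderivative_at_infinity ::
    "('a::real_inner \<Rightarrow> 'b::real_inner set) \<Rightarrow> 'b \<Rightarrow> 'b \<Rightarrow> 'a set" where
  "coderivative_at_infinity F y v = {u. (u, - v) \<in> normal_cone_at_infinity (gph F) y}"

end

theory Submission
  imports Defs
begin

text \<open>
  The graph of \<open>F2 \<circ>\<^sub>s F1\<close> is the relational composition \<open>A O B\<close> of the two
  graphs, so everything is stated for closed relations \<open>A\<close> and \<open>B\<close>.

  The core is a chain rule up to an error at one finite point, \<open>fuzzy_chain_rule\<close>: a regular normal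
  \<open>(u, v)\<close> to \<open>A O B\<close> at \<open>(x, y)\<close> splits, for each intermediate point \<open>z\<close>, into regular normals to
  \<open>A\<close> and \<open>B\<close> at nearby points that are close to \<open>(u, - w)\<close> and \<open>(w, v)\<close> for a common multiplier
  \<open>w\<close>. To see this, decouple the two copies of \<open>z\<close> and penalise their squared distance;
  \<open>w\<close> is the derivative of the penalty. The size of \<open>w\<close> is uncontrolled at this stage.

  Along a sequence \<open>(x k, y k)\<close> going to \<open>(\<infinity>, ybar)\<close>, the boundedness condition makes
  intermediate points \<open>z k\<close> cluster at some point of the set \<open>jelonek_comp_set F2 F1 ybar\<close>.
  Apply the fuzzy rule with errors tending to \<open>0\<close>. If the multipliers were unbounded, dividing by their
  norms would yield in the limit a unit vector \<open>w\<close> with \<open>(0, - w)\<close> normal to \<open>A\<close> and \<open>(w, 0)\<close>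
  normal to \<open>B\<close>, which is exactly what the qualification forbids. Hence they have a cluster point, and this is
  the intermediate covector of the inclusion (\<open>normal_cone_at_infinity_relcomp\<close>).
  The local closedness of the graph follows from the same compactness of intermediate points.
\<close>

section \<open>Penalised maximisation\<close>

text \<open>
  Maximisers for growing penalty weights cluster at a point where \<open>d\<close> vanishes
  and whose value is still at least \<open>f p0\<close>; the assumption on \<open>U\<close> places that point in \<open>U\<close>,
  and openness then does the same for a maximiser with a finite weight.
\<close>
lemma penalised_maximiser_in_open:
  fixes f d :: "'a::metric_space \<Rightarrow> real"
  assumes K: "compact K" and f: "continuous_on K f" and d: "continuous_on K d"
    and d0: "\<And>p. p \<in> K \<Longrightarrow> d p \<ge> 0"
    and p0: "p0 \<in> K" "d p0 = 0"
    and U: "open U" "\<And>p. \<lbrakk>p \<in> K; d p = 0; f p \<ge> f p0\<rbrakk> \<Longrightarrow> p \<in> U"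
  shows "\<exists>M\<ge>0. \<exists>p \<in> K \<inter> U. \<forall>q \<in> K. f q - M * d q \<le> f p - M * d p"
proof -
  have "\<exists>p \<in> K. \<forall>q \<in> K. f q - real n * d q \<le> f p - real n * d p" for n
    using p0(1) by (intro continuous_attains_sup[OF K] continuous_intros f d) auto
  then obtain p where p: "\<And>n. p n \<in> K"
    and max: "\<And>n q. q \<in> K \<Longrightarrow> f q - real n * d q \<le> f (p n) - real n * d (p n)"
    by metis
  obtain l r where l: "l \<in> K" and r: "strict_mono r" and lim: "(p \<circ> r) \<longlonglongrightarrow> l"
    using K p unfolding compact_def by meson
  have f_lim: "(\<lambda>n. f (p (r n))) \<longlonglongrightarrow> f l"
    using continuous_on_tendsto_compose[OF f lim l] p by (simp add: o_def)
  have d_lim: "(\<lambda>n. d (p (r n))) \<longlonglongrightarrow> d l"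
    using continuous_on_tendsto_compose[OF d lim l] p by (simp add: o_def)
  have above: "f p0 + real (r n) * d (p (r n)) \<le> f (p (r n))" for n
    using max[OF p0(1), of "r n"] p0(2) by simp
  have "f p0 \<le> f (p (r n))" for n
    using above[of n] d0[OF p[of "r n"]] by (smt (verit) mult_nonneg_nonneg of_nat_0_le_iff)
  then have "f p0 \<le> f l"
    using f_lim by (intro LIMSEQ_le_const) auto
  moreover have "d l = 0"
  proof -
    obtain B where B: "\<And>q. q \<in> K \<Longrightarrow> f q \<le> B"
      using continuous_attains_sup[OF K _ f] p0(1) by blast
    have "d (p (r n)) \<le> (B - f p0) / real (r n)" if "n > 0" for n
    proof -
      have "r n > 0"
        using seq_suble[OF r, of n] that by linarith
      moreover have "real (r n) * d (p (r n)) \<le> B - f p0"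
        using above[of n] B[OF p[of "r n"]] by linarith
      ultimately show ?thesis
        by (simp add: field_simps)
    qed
    moreover have "(\<lambda>n. (B - f p0) / real (r n)) \<longlonglongrightarrow> 0"
      using LIMSEQ_subseq_LIMSEQ[OF lim_const_over_n r] by (simp add: o_def)
    ultimately have "d l \<le> 0"
      using d_lim by (intro tendsto_le[OF sequentially_bot]) (auto intro: eventually_mono[OF eventually_gt_at_top[of 0]])
    with d0[OF l] show ?thesis by simp
  qed
  ultimately have "l \<in> U"
    using U(2) l by blast
  then have "\<forall>\<^sub>F n in sequentially. (p \<circ> r) n \<in> U"
    using lim U(1) by (rule topological_tendstoD[rotated -1])
  then obtain n where "p (r n) \<in> U"
    by (auto simp: eventually_sequentially)
  with p max show ?thesis
    by (intro exI[of _ "real (r n)"]) auto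
qed

section \<open>Regular normals\<close>

lemma proximal_imp_regular_normal:
  assumes "eventually (\<lambda>z'. inner \<xi> (z' - z) \<le> M * (norm (z' - z))\<^sup>2) (at z within \<Omega>)"
  shows "\<xi> \<in> regular_normal_cone \<Omega> z"
  unfolding regular_normal_cone_def
proof (intro CollectI allI impI)
  fix \<epsilon> :: real assume "\<epsilon> > 0"
  have "((\<lambda>z'. M * norm (z' - z)) \<longlongrightarrow> M * norm (z - z)) (at z within \<Omega>)"
    by (intro tendsto_intros)
  then have "eventually (\<lambda>z'. M * norm (z' - z) < \<epsilon>) (at z within \<Omega>)"
    using \<open>\<epsilon> > 0\<close> by (intro order_tendstoD(2)) auto
  with assms show "eventually (\<lambda>z'. inner \<xi> (z' - z) \<le> \<epsilon> * norm (z' - z)) (at z within \<Omega>)"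
  proof eventually_elim
    case (elim z')
    have "M * (norm (z' - z))\<^sup>2 = M * norm (z' - z) * norm (z' - z)"
      by (simp add: power2_eq_square)
    also have "\<dots> \<le> \<epsilon> * norm (z' - z)"
      using elim(2) by (intro mult_right_mono) auto
    finally show ?case using elim(1) by linarith
  qed
qed

lemma regular_normal_cone_scale:
  assumes "\<xi> \<in> regular_normal_cone \<Omega> z" "t \<ge> 0"
  shows "t *\<^sub>R \<xi> \<in> regular_normal_cone \<Omega> z"
proof (cases "t = 0")
  case True
  then show ?thesis by (auto simp: regular_normal_cone_def)
next
  case False
  with assms(2) have t: "t > 0" by simp
  show ?thesis
    unfolding regular_normal_cone_def
  proof (intro CollectI allI impI)
    fix \<epsilon> :: real assume "\<epsilon> > 0"
    with t have "\<epsilon> / t > 0" by simp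
    with assms(1) have "eventually (\<lambda>z'. inner \<xi> (z' - z) \<le> \<epsilon> / t * norm (z' - z)) (at z within \<Omega>)"
      unfolding regular_normal_cone_def by blast
    then show "eventually (\<lambda>z'. inner (t *\<^sub>R \<xi>) (z' - z) \<le> \<epsilon> * norm (z' - z)) (at z within \<Omega>)"
      by eventually_elim (use t in \<open>simp add: field_simps\<close>)
  qed
qed

text \<open>
  First-order optimality. A quadratic lower bound takes the place of differentiability of \<open>\<phi>\<close>; for the
  quadratic objectives met below it comes from expanding the squares.
\<close>
lemma regular_normal_cone_if_local_max:
  fixes \<phi> :: "'a::euclidean_space \<Rightarrow> real"
  assumes "open U" "a \<in> U"
    and max: "\<And>a'. \<lbrakk>a' \<in> \<Omega>; a' \<in> U\<rbrakk> \<Longrightarrow> \<phi> a' \<le> \<phi> a"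
    and expand: "\<And>a'. \<phi> a' - \<phi> a \<ge> inner \<xi> (a' - a) - M * (norm (a' - a))\<^sup>2"
  shows "\<xi> \<in> regular_normal_cone \<Omega> a"
proof (rule proximal_imp_regular_normal)
  have "eventually (\<lambda>a'. a' \<in> U \<and> a' \<in> \<Omega>) (at a within \<Omega>)"
    using assms(1,2) by (auto simp: eventually_at_topological)
  then show "eventually (\<lambda>a'. inner \<xi> (a' - a) \<le> M * (norm (a' - a))\<^sup>2) (at a within \<Omega>)"
    by eventually_elim (use max expand in \<open>smt (verit)\<close>)
qed

lemma norm_diff_sq_expand:
  fixes a a' b :: "'a::real_inner"
  shows "(norm (a' - b))\<^sup>2 = (norm (a - b))\<^sup>2 + 2 * inner (a - b) (a' - a) + (norm (a' - a))\<^sup>2"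
  by (simp add: power2_norm_eq_inner algebra_simps inner_commute)

section \<open>The fuzzy chain rule\<close>

text \<open>
  Regularity of \<open>(u, v)\<close> bounds a linear functional by \<open>\<epsilon>\<close> times a norm, which is
  not differentiable at the base point. Subtracting instead the smooth term \<open>(\<epsilon> / s) * t\<^sup>2\<close>, with
  \<open>t\<close> the distance to the base point, leaves at most \<open>\<epsilon> * t - (\<epsilon> / s) * t\<^sup>2\<close>. This is negative for
  \<open>t > s\<close>, so maximisers with coinciding copies of \<open>z\<close> stay within distance \<open>s\<close>, and penalised
  ones, for a suitable weight, within \<open>2 * s\<close>, where the gradient of the smooth term is of order
  \<open>\<epsilon>\<close>. All normals obtained are therefore exact regular normals, at the price of a small
  perturbation.
\<close>
lemma fuzzy_chain_rule:
  fixes A :: "('a::euclidean_space \<times> 'b::euclidean_space) set"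
    and B :: "('b \<times> 'c::euclidean_space) set"
  assumes A: "closed A" and B: "closed B" and xz: "(x, z) \<in> A" and zy: "(z, y) \<in> B"
    and normal: "(u, v) \<in> regular_normal_cone (A O B) (x, y)"
    and e: "e > 0"
  shows "\<exists>a b \<xi> \<zeta> w. a \<in> A \<and> b \<in> B \<and> dist a (x, z) \<le> e \<and> dist b (z, y) \<le> e \<and>
    \<xi> \<in> regular_normal_cone A a \<and> \<zeta> \<in> regular_normal_cone B b \<and>
    dist \<xi> (u, - w) \<le> e \<and> dist \<zeta> (w, v) \<le> e"
proof -
  \<comment> \<open>The maximiser is only known to lie within \<open>2 * s\<close> of the base point, so the gradient of the
      smooth term has norm at most \<open>2 * (\<epsilon> / s) * (2 * s) = 4 * \<epsilon>\<close>.\<close>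
  define \<epsilon> where "\<epsilon> = e / 4"
  have \<epsilon>: "\<epsilon> > 0" using e by (simp add: \<epsilon>_def)
  have "eventually (\<lambda>q. inner (u, v) (q - (x, y)) \<le> \<epsilon> * norm (q - (x, y))) (at (x, y) within A O B)"
    using normal \<epsilon> unfolding regular_normal_cone_def by blast
  then obtain r where r: "r > 0" and bound0: "\<And>q. \<lbrakk>q \<in> A O B; q \<noteq> (x, y); dist q (x, y) < r\<rbrakk> \<Longrightarrow>
      inner (u, v) (q - (x, y)) \<le> \<epsilon> * norm (q - (x, y))"
    unfolding eventually_at by blast
  have bound: "inner (u, v) (q - (x, y)) \<le> \<epsilon> * norm (q - (x, y))"
    if "q \<in> A O B" "dist q (x, y) < r" for q
    using bound0[of q] that by (cases "q = (x, y)") auto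
  define s where "s = min (e / 2) (r / 8)"
  have s: "s > 0" "2 * s \<le> e" "8 * s \<le> r" using r e by (auto simp: s_def)
  define c where "c = \<epsilon> / s"
  have c: "c > 0" "c * s = \<epsilon>" using \<epsilon> s by (auto simp: c_def)
  define K where "K = (A \<inter> cball (x, z) (2 * s)) \<times> (B \<inter> cball (z, y) (2 * s))"
  define U where "U = ball (x, z) (2 * s) \<times> ball (z, y) (2 * s)"
  define f where "f p = inner (u, 0) (fst p - (x, z)) + inner (0, v) (snd p - (z, y))
      - c * (norm (fst p - (x, z)))\<^sup>2 - c * (norm (snd p - (z, y)))\<^sup>2" for p :: "('a \<times> 'b) \<times> ('b \<times> 'c)"
  define d where "d p = (norm (snd (fst p) - fst (snd p)))\<^sup>2" for p :: "('a \<times> 'b) \<times> ('b \<times> 'c)"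
  have "\<exists>M\<ge>0. \<exists>p \<in> K \<inter> U. \<forall>q \<in> K. f q - M * d q \<le> f p - M * d p"
  proof (rule penalised_maximiser_in_open)
    show "compact K"
      unfolding K_def using A B by (intro compact_Times closed_Int_compact) auto
    show "continuous_on K f" "continuous_on K d"
      unfolding f_def d_def by (intro continuous_intros)+
    show "((x, z), (z, y)) \<in> K" "d ((x, z), (z, y)) = 0"
      using xz zy s by (auto simp: K_def d_def)
    show "open U" by (auto simp: U_def intro: open_Times)
    show "p \<in> U" if p: "p \<in> K" "d p = 0" "f ((x, z), (z, y)) \<le> f p" for p
    proof -
      obtain x' z' y' where p_eq: "p = ((x', z'), (z', y'))"
        using p(2) by (cases p) (auto simp: d_def)
      define t where "t = norm (p - ((x, z), (z, y)))"
      have t2: "t\<^sup>2 = (norm ((x', z') - (x, z)))\<^sup>2 + (norm ((z', y') - (z, y)))\<^sup>2"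
        by (simp add: t_def p_eq norm_prod_def)
      have t0: "t \<ge> 0" by (simp add: t_def)
      have da: "norm ((x', z') - (x, z)) \<le> t" and db: "norm ((z', y') - (z, y)) \<le> t"
        by (rule power2_le_imp_le[OF _ t0], unfold t2, simp)+
      have xy: "norm ((x', y') - (x, y)) \<le> t"
        by (rule power2_le_imp_le[OF _ t0], unfold t2) (simp add: norm_prod_def)
      have "t \<le> 4 * s"
      proof -
        have "t \<le> norm ((x', z') - (x, z)) + norm ((z', y') - (z, y))"
          unfolding t_def p_eq by (simp add: norm_Pair_le)
        moreover have "dist (x', z') (x, z) \<le> 2 * s" "dist (z', y') (z, y) \<le> 2 * s"
          using p(1) by (auto simp: K_def p_eq dist_commute)
        ultimately show ?thesis unfolding dist_norm by linarith
      qed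
      then have "dist (x', y') (x, y) < r"
        using xy s by (simp add: dist_norm)
      moreover have "(x', y') \<in> A O B"
        using p(1) by (auto simp: K_def p_eq)
      ultimately have "inner (u, v) ((x', y') - (x, y)) \<le> \<epsilon> * norm ((x', y') - (x, y))"
        by (intro bound)
      also have "\<dots> \<le> \<epsilon> * t" using xy \<epsilon> by (intro mult_left_mono) auto
      finally have "f p \<le> \<epsilon> * t - c * t\<^sup>2"
        by (simp add: f_def p_eq t2 algebra_simps)
      with p(3) have "c * t\<^sup>2 \<le> c * s * t"
        by (simp add: f_def c(2))
      then have "t \<le> s"
        using c(1) s(1) by (auto simp: power2_eq_square mult_le_cancel_left mult_le_cancel_right t_def)
      then show "p \<in> U"
        using da db s(1)
        unfolding U_def p_eq mem_Times_iff mem_ball fst_conv snd_conv dist_norm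
          norm_minus_commute[of "(x, z)"] norm_minus_commute[of "(z, y)"] by linarith
    qed
  qed (auto simp: d_def)
  then obtain M a b where M: "M \<ge> 0" and ab: "(a, b) \<in> K" "(a, b) \<in> U"
    and max: "\<And>q. q \<in> K \<Longrightarrow> f q - M * d q \<le> f (a, b) - M * d (a, b)"
    by auto
  \<comment> \<open>The gradient of the penalty in the first copy of \<open>z\<close>; in the second copy it is \<open>- w\<close>. Hence the
      multipliers in the two normals below match up.\<close>
  define w where "w = (2 * M) *\<^sub>R (snd a - fst b)"
  define \<xi> where "\<xi> = (u, - w) - (2 * c) *\<^sub>R (a - (x, z))"
  define \<zeta> where "\<zeta> = (w, v) - (2 * c) *\<^sub>R (b - (z, y))"
  have "\<xi> \<in> regular_normal_cone A a"
  proof (rule regular_normal_cone_if_local_max[where \<phi> = "\<lambda>a'. f (a', b) - M * d (a', b)" and M = "c + M"])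
    show "open (ball (x, z) (2 * s))" "a \<in> ball (x, z) (2 * s)"
      using ab(2) by (auto simp: U_def)
    show "f (a', b) - M * d (a', b) \<le> f (a, b) - M * d (a, b)"
      if "a' \<in> A" "a' \<in> ball (x, z) (2 * s)" for a'
      using that ab(1) by (intro max) (auto simp: K_def)
    show "inner \<xi> (a' - a) - (c + M) * (norm (a' - a))\<^sup>2
        \<le> f (a', b) - M * d (a', b) - (f (a, b) - M * d (a, b))" for a'
    proof -
      have "(norm (snd a' - snd a))\<^sup>2 \<le> (norm (a' - a))\<^sup>2"
        by (simp add: norm_prod_def)
      then have "M * (norm (snd a' - snd a))\<^sup>2 \<le> M * (norm (a' - a))\<^sup>2"
        using M by (rule mult_left_mono)
      then show ?thesis
        unfolding f_def d_def fst_conv snd_conv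
          norm_diff_sq_expand[of a' "(x, z)" a] norm_diff_sq_expand[of "snd a'" "fst b" "snd a"]
        by (simp add: \<xi>_def w_def inner_prod_def algebra_simps)
    qed
  qed
  moreover have "\<zeta> \<in> regular_normal_cone B b"
  proof (rule regular_normal_cone_if_local_max[where \<phi> = "\<lambda>b'. f (a, b') - M * d (a, b')" and M = "c + M"])
    show "open (ball (z, y) (2 * s))" "b \<in> ball (z, y) (2 * s)"
      using ab(2) by (auto simp: U_def)
    show "f (a, b') - M * d (a, b') \<le> f (a, b) - M * d (a, b)"
      if "b' \<in> B" "b' \<in> ball (z, y) (2 * s)" for b'
      using that ab(1) by (intro max) (auto simp: K_def)
    show "inner \<zeta> (b' - b) - (c + M) * (norm (b' - b))\<^sup>2
        \<le> f (a, b') - M * d (a, b') - (f (a, b) - M * d (a, b))" for b'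
    proof -
      have "(norm (fst b' - fst b))\<^sup>2 \<le> (norm (b' - b))\<^sup>2"
        by (simp add: norm_prod_def)
      then have "M * (norm (fst b' - fst b))\<^sup>2 \<le> M * (norm (b' - b))\<^sup>2"
        using M by (rule mult_left_mono)
      then show ?thesis
        unfolding f_def d_def fst_conv snd_conv
          norm_diff_sq_expand[of b' "(z, y)" b] norm_minus_commute[of "snd a"]
          norm_diff_sq_expand[of "fst b'" "snd a" "fst b"]
        by (simp add: \<zeta>_def w_def inner_prod_def algebra_simps)
    qed
  qed
  moreover have near: "dist a (x, z) \<le> 2 * s" "dist b (z, y) \<le> 2 * s"
    using ab(1) by (auto simp: K_def dist_commute)
  moreover have "dist \<xi> (u, - w) \<le> e" "dist \<zeta> (w, v) \<le> e"
  proof -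
    have "2 * c * t \<le> e" if "t \<le> 2 * s" for t
    proof -
      have "2 * c * t \<le> 2 * c * (2 * s)"
        using that c(1) by (intro mult_left_mono) auto
      also have "\<dots> = e" using c(2) by (simp add: \<epsilon>_def)
      finally show ?thesis .
    qed
    then show "dist \<xi> (u, - w) \<le> e" "dist \<zeta> (w, v) \<le> e"
      using near c(1) by (simp_all add: \<xi>_def \<zeta>_def dist_norm)
  qed
  ultimately show ?thesis
    using ab(1) s(2) unfolding K_def
    by (intro exI[of _ a] exI[of _ b] exI[of _ \<xi>] exI[of _ \<zeta>] exI[of _ w]) auto
qed

section \<open>Passage to infinity\<close>

lemma eventually_bounded_imp_convergent_subseq:
  fixes f :: "nat \<Rightarrow> 'a::euclidean_space"
  assumes "eventually (\<lambda>n. norm (f n) \<le> B) sequentially"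
  obtains r l where "strict_mono r" "(\<lambda>n. f (r n)) \<longlonglongrightarrow> l"
proof -
  have "Bseq f" using assms by (rule BfunI)
  then have "bounded (range f)" by (simp add: Bseq_eq_bounded)
  then show thesis
    using bounded_imp_convergent_subsequence that unfolding o_def by metis
qed

lemma gph_sv_comp: "gph (F2 \<circ>\<^sub>s F1) = gph F1 O gph F2"
  by (auto simp: gph_def sv_comp_def sv_inv_def)

lemma locally_closed_at_infinity_relcomp:
  fixes A :: "('a::euclidean_space \<times> 'b::euclidean_space) set"
    and B :: "('b \<times> 'c::euclidean_space) set"
  assumes A: "closed A" and B: "closed B" and y0: "y0 \<in> interior V" and R: "R > 0"
    and bdd: "\<And>x z y. \<lbrakk>norm x > R; y \<in> V; (x, z) \<in> A; (z, y) \<in> B\<rbrakk> \<Longrightarrow> norm z \<le> R'"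
  shows "locally_closed_at_infinity (A O B) y0"
proof -
  obtain e where e: "e > 0" and eV: "cball y0 e \<subseteq> V"
    using y0 by (auto simp: mem_interior_cball)
  \<comment> \<open>\<open>R + 1\<close> instead of \<open>R\<close>: the bound on \<open>z\<close> requires \<open>norm x > R\<close>, which is not a closed condition.\<close>
  let ?S = "{(x, y). (x, y) \<in> A O B \<and> norm x \<ge> R + 1 \<and> y \<in> cball y0 e}"
  have "closed ?S"
    unfolding closed_sequential_limits
  proof (intro allI impI, elim conjE)
    fix q l assume q: "\<forall>n::nat. q n \<in> ?S" and lim: "q \<longlonglongrightarrow> l"
    have x_lim: "(\<lambda>n. fst (q n)) \<longlonglongrightarrow> fst l" and y_lim: "(\<lambda>n. snd (q n)) \<longlonglongrightarrow> snd l"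
      using lim by (auto intro: tendsto_intros)
    have "\<forall>n. \<exists>z. (fst (q n), z) \<in> A \<and> (z, snd (q n)) \<in> B"
    proof
      fix n
      have "(fst (q n), snd (q n)) \<in> A O B" using q[rule_format, of n] by (auto simp: split_beta)
      then show "\<exists>z. (fst (q n), z) \<in> A \<and> (z, snd (q n)) \<in> B" by blast
    qed
    then obtain z where z: "\<And>n. (fst (q n), z n) \<in> A" "\<And>n. (z n, snd (q n)) \<in> B"
      by metis
    have q': "norm (fst (q n)) \<ge> R + 1" "snd (q n) \<in> cball y0 e" for n
      using q[rule_format, of n] by (auto simp: split_beta)
    have "norm (z n) \<le> R'" for n
      by (rule bdd[OF _ _ z]) (use q'[of n] eV in auto)
    then obtain r z0 where r: "strict_mono r" and z_lim: "(\<lambda>n. z (r n)) \<longlonglongrightarrow> z0"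
      using eventually_bounded_imp_convergent_subseq[of z R'] by auto
    have x_lim': "(\<lambda>n. fst (q (r n))) \<longlonglongrightarrow> fst l" and y_lim': "(\<lambda>n. snd (q (r n))) \<longlonglongrightarrow> snd l"
      using LIMSEQ_subseq_LIMSEQ[OF x_lim r] LIMSEQ_subseq_LIMSEQ[OF y_lim r] by (simp_all add: o_def)
    have "(fst l, z0) \<in> A"
      by (rule closed_sequentially[OF A _ tendsto_Pair[OF x_lim' z_lim]]) (rule z)
    moreover have "(z0, snd l) \<in> B"
      by (rule closed_sequentially[OF B _ tendsto_Pair[OF z_lim y_lim']]) (rule z)
    moreover have "norm (fst l) \<ge> R + 1"
      using q'(1) by (intro LIMSEQ_le_const[OF tendsto_norm[OF x_lim]]) auto
    moreover have "snd l \<in> cball y0 e"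
      by (rule closed_sequentially[OF closed_cball _ y_lim]) (rule q')
    ultimately show "l \<in> ?S" by (cases l) auto
  qed
  then show ?thesis
    unfolding locally_closed_at_infinity_def
    using R e by (intro exI[of _ "R + 1"] conjI exI[of _ "cball y0 e"]) auto
qed

text \<open>
  The multipliers \<open>w k\<close> of the fuzzy chain rule are rescaled by \<open>t k = 1 / (1 + norm (w k))\<close>, so that
  \<open>t k\<close> and \<open>t k *\<^sub>R w k\<close> have limits \<open>\<sigma>\<close> and \<open>\<omega>\<close> along a subsequence, with
  \<open>\<sigma> + norm \<omega> = 1\<close>. The case \<open>\<sigma> = 0\<close> is that of unbounded multipliers, ruled out by \<open>cq\<close>;
  for \<open>\<sigma> \<noteq> 0\<close> the multipliers themselves converge to \<open>\<omega> / \<sigma>\<close>.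
\<close>
lemma normal_cone_at_infinity_relcomp:
  fixes A :: "('a::euclidean_space \<times> 'b::euclidean_space) set"
    and B :: "('b \<times> 'c::euclidean_space) set"
  assumes A: "closed A" and B: "closed B"
    and x_inf: "filterlim (\<lambda>k. norm (x k)) at_top sequentially"
    and z_lim: "z \<longlonglongrightarrow> z0" and y_lim: "y \<longlonglongrightarrow> y0"
    and xz: "\<And>k. (x k, z k) \<in> A" and zy: "\<And>k. (z k, y k) \<in> B"
    and normal: "\<And>k. (u k, v k) \<in> regular_normal_cone (A O B) (x k, y k)"
    and u_lim: "u \<longlonglongrightarrow> u0" and v_lim: "v \<longlonglongrightarrow> v0"
    and cq: "\<And>w. \<lbrakk>(0, - w) \<in> normal_cone_at_infinity A z0; (w, 0) \<in> limiting_normal_cone B (z0, y0)\<rbrakk>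
      \<Longrightarrow> w = 0"
  shows "\<exists>w. (u0, - w) \<in> normal_cone_at_infinity A z0 \<and> (w, v0) \<in> limiting_normal_cone B (z0, y0)"
proof -
  define e :: "nat \<Rightarrow> real" where "e k = inverse (real (Suc k))" for k
  have e: "e k > 0" "e k \<le> 1" for k by (auto simp: e_def field_simps)
  have e_lim: "e \<longlonglongrightarrow> 0" unfolding e_def by (rule LIMSEQ_inverse_real_of_nat)
  have "\<forall>k. \<exists>a b \<xi> \<zeta> w. a \<in> A \<and> b \<in> B \<and> dist a (x k, z k) \<le> e k \<and> dist b (z k, y k) \<le> e k \<and>
    \<xi> \<in> regular_normal_cone A a \<and> \<zeta> \<in> regular_normal_cone B b \<and>
    dist \<xi> (u k, - w) \<le> e k \<and> dist \<zeta> (w, v k) \<le> e k"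
    using fuzzy_chain_rule[OF A B xz zy normal e(1)] by blast
  then obtain a b \<xi> \<zeta> w where a: "\<And>k. a k \<in> A" "\<And>k. dist (a k) (x k, z k) \<le> e k"
    and b: "\<And>k. b k \<in> B" "\<And>k. dist (b k) (z k, y k) \<le> e k"
    and \<xi>: "\<And>k. \<xi> k \<in> regular_normal_cone A (a k)" "\<And>k. dist (\<xi> k) (u k, - w k) \<le> e k"
    and \<zeta>: "\<And>k. \<zeta> k \<in> regular_normal_cone B (b k)" "\<And>k. dist (\<zeta> k) (w k, v k) \<le> e k"
    by metis
  have b_lim: "b \<longlonglongrightarrow> (z0, y0)"
  proof -
    have "(\<lambda>k. dist (b k) (z k, y k)) \<longlonglongrightarrow> 0"
      by (rule tendsto_sandwich[OF _ _ tendsto_const e_lim]) (auto simp: b(2))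
    then show ?thesis
      by (intro Lim_transform[OF tendsto_Pair[OF z_lim y_lim]]) (simp add: dist_norm tendsto_norm_zero_iff)
  qed
  have az_lim: "(\<lambda>k. snd (a k)) \<longlonglongrightarrow> z0"
  proof -
    have "(\<lambda>k. dist (snd (a k)) (z k)) \<longlonglongrightarrow> 0"
    proof (rule tendsto_sandwich[OF _ _ tendsto_const e_lim])
      have "dist (snd (a k)) (z k) \<le> e k" for k
        using dist_snd_le[of "a k" "(x k, z k)"] a(2)[of k] by simp
      then show "\<forall>\<^sub>F k in sequentially. dist (snd (a k)) (z k) \<le> e k" by simp
    qed auto
    then show ?thesis
      by (intro Lim_transform[OF z_lim]) (simp add: dist_norm tendsto_norm_zero_iff)
  qed
  have ax_inf: "filterlim (\<lambda>k. norm (fst (a k))) at_top sequentially"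
  proof (rule filterlim_at_top_mono)
    show "filterlim (\<lambda>k. - 1 + norm (x k)) at_top sequentially"
      by (rule filterlim_tendsto_add_at_top[OF tendsto_const x_inf])
    have "- 1 + norm (x k) \<le> norm (fst (a k))" for k
    proof -
      have "norm (x k - fst (a k)) \<le> 1"
        using dist_fst_le[of "a k" "(x k, z k)"] a(2)[of k] e(2)[of k]
        by (simp add: dist_norm norm_minus_commute)
      then show ?thesis using norm_triangle_ineq2[of "x k" "fst (a k)"] by linarith
    qed
    then show "\<forall>\<^sub>F k in sequentially. - 1 + norm (x k) \<le> norm (fst (a k))" by simp
  qed
  \<comment> \<open>Used twice: with the scaling by \<open>1 / (1 + norm (w k))\<close> to bound the multipliers, and unscaled to
      conclude.\<close>
  have scaled_limit: "(\<sigma> *\<^sub>R u0, - \<omega>) \<in> normal_cone_at_infinity A z0 \<and>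
      (\<omega>, \<sigma> *\<^sub>R v0) \<in> limiting_normal_cone B (z0, y0)"
    if r: "strict_mono r" and t: "\<And>k. t k \<ge> 0" and \<sigma>: "t \<longlonglongrightarrow> \<sigma>"
      and \<omega>: "(\<lambda>k. t k *\<^sub>R w (r k)) \<longlonglongrightarrow> \<omega>" for r :: "nat \<Rightarrow> nat" and t \<sigma> \<omega>
  proof -
    note sub = LIMSEQ_subseq_LIMSEQ[OF _ r, unfolded o_def]
    have te: "(\<lambda>k. t k * e (r k)) \<longlonglongrightarrow> 0"
      using tendsto_mult[OF \<sigma> sub[OF e_lim]] by simp
    have \<xi>_lim: "(\<lambda>k. t k *\<^sub>R \<xi> (r k)) \<longlonglongrightarrow> (\<sigma> *\<^sub>R u0, - \<omega>)"
    proof (rule Lim_transform)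
      show "(\<lambda>k. (t k *\<^sub>R u (r k), - (t k *\<^sub>R w (r k)))) \<longlonglongrightarrow> (\<sigma> *\<^sub>R u0, - \<omega>)"
        by (intro tendsto_intros \<sigma> \<omega> sub u_lim)
      show "(\<lambda>k. t k *\<^sub>R \<xi> (r k) - (t k *\<^sub>R u (r k), - (t k *\<^sub>R w (r k)))) \<longlonglongrightarrow> 0"
      proof (rule Lim_null_comparison[OF _ te], intro always_eventually allI)
        fix k
        have "norm (t k *\<^sub>R (\<xi> (r k) - (u (r k), - w (r k)))) \<le> t k * e (r k)"
          using \<xi>(2)[of "r k"] t[of k] by (simp add: dist_norm mult_left_mono)
        then show "norm (t k *\<^sub>R \<xi> (r k) - (t k *\<^sub>R u (r k), - (t k *\<^sub>R w (r k)))) \<le> t k * e (r k)"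
          by (simp add: scaleR_diff_right)
      qed
    qed
    have \<zeta>_lim: "(\<lambda>k. t k *\<^sub>R \<zeta> (r k)) \<longlonglongrightarrow> (\<omega>, \<sigma> *\<^sub>R v0)"
    proof (rule Lim_transform)
      show "(\<lambda>k. (t k *\<^sub>R w (r k), t k *\<^sub>R v (r k))) \<longlonglongrightarrow> (\<omega>, \<sigma> *\<^sub>R v0)"
        by (intro tendsto_intros \<sigma> \<omega> sub v_lim)
      show "(\<lambda>k. t k *\<^sub>R \<zeta> (r k) - (t k *\<^sub>R w (r k), t k *\<^sub>R v (r k))) \<longlonglongrightarrow> 0"
      proof (rule Lim_null_comparison[OF _ te], intro always_eventually allI)
        fix k
        have "norm (t k *\<^sub>R (\<zeta> (r k) - (w (r k), v (r k)))) \<le> t k * e (r k)"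
          using \<zeta>(2)[of "r k"] t[of k] by (simp add: dist_norm mult_left_mono)
        then show "norm (t k *\<^sub>R \<zeta> (r k) - (t k *\<^sub>R w (r k), t k *\<^sub>R v (r k))) \<le> t k * e (r k)"
          by (simp add: scaleR_diff_right)
      qed
    qed
    have "(\<sigma> *\<^sub>R u0, - \<omega>) \<in> normal_cone_at_infinity A z0"
      unfolding normal_cone_at_infinity_def
      using a(1) \<xi>(1) t \<xi>_lim sub[OF az_lim] filterlim_compose[OF ax_inf filterlim_subseq[OF r]]
      by (intro CollectI exI[of _ "\<lambda>k. fst (a (r k))"] exI[of _ "\<lambda>k. snd (a (r k))"]
            exI[of _ "\<lambda>k. t k *\<^sub>R \<xi> (r k)"]) (auto intro: regular_normal_cone_scale)
    moreover have "(\<omega>, \<sigma> *\<^sub>R v0) \<in> limiting_normal_cone B (z0, y0)"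
      unfolding limiting_normal_cone_def
      using b(1) \<zeta>(1) t \<zeta>_lim sub[OF b_lim]
      by (intro CollectI exI[of _ "\<lambda>k. b (r k)"] exI[of _ "\<lambda>k. t k *\<^sub>R \<zeta> (r k)"])
         (auto intro: regular_normal_cone_scale)
    ultimately show ?thesis ..
  qed
  define t where "t k = inverse (1 + norm (w k))" for k
  have pos: "1 + norm (w k) > 0" for k by (smt (verit) norm_ge_zero)
  have t: "t k > 0" for k using pos by (simp add: t_def)
  have t_sum: "t k + norm (t k *\<^sub>R w k) = 1" for k
    using pos[of k] by (simp add: t_def field_simps)
  have "norm (t k, t k *\<^sub>R w k) \<le> 1" for k
    using norm_Pair_le[of "t k" "t k *\<^sub>R w k"] t_sum[of k] t[of k] by simp
  then have "\<forall>\<^sub>F k in sequentially. norm (t k, t k *\<^sub>R w k) \<le> 1" by simp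
  then obtain r l where r: "strict_mono r" and l: "(\<lambda>k. (t (r k), t (r k) *\<^sub>R w (r k))) \<longlonglongrightarrow> l"
    by (rule eventually_bounded_imp_convergent_subseq)
  obtain \<sigma> \<omega> where "l = (\<sigma>, \<omega>)" by (cases l)
  with l have \<sigma>: "(\<lambda>k. t (r k)) \<longlonglongrightarrow> \<sigma>" and \<omega>: "(\<lambda>k. t (r k) *\<^sub>R w (r k)) \<longlonglongrightarrow> \<omega>"
    using tendsto_fst[OF l] tendsto_snd[OF l] by auto
  have \<sigma>_sum: "\<sigma> + norm \<omega> = 1"
    using LIMSEQ_unique[OF tendsto_add[OF \<sigma> tendsto_norm[OF \<omega>]]] t_sum by simp
  have "\<sigma> \<noteq> 0"
  proof
    assume "\<sigma> = 0"
    with scaled_limit[OF r _ \<sigma> \<omega>] t have "\<omega> = 0"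
      by (intro cq) (auto simp: less_imp_le)
    with \<sigma>_sum \<open>\<sigma> = 0\<close> show False by simp
  qed
  have "(\<lambda>k. inverse (t (r k)) *\<^sub>R (t (r k) *\<^sub>R w (r k))) \<longlonglongrightarrow> inverse \<sigma> *\<^sub>R \<omega>"
    using \<open>\<sigma> \<noteq> 0\<close> by (intro tendsto_intros \<sigma> \<omega>)
  moreover have "inverse (t k) *\<^sub>R (t k *\<^sub>R w k) = w k" for k
    using t[of k] by simp
  ultimately have "(\<lambda>k. 1 *\<^sub>R w (r k)) \<longlonglongrightarrow> inverse \<sigma> *\<^sub>R \<omega>"
    by simp
  from scaled_limit[OF r _ tendsto_const this] show ?thesis by auto
qed

section \<open>The chain rule for coderivatives at infinity\<close>

theorem theorem3p9:
  fixes F1 :: "real ^ 'n \<Rightarrow> (real ^ 'p) set"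
    and F2 :: "real ^ 'p \<Rightarrow> (real ^ 'm) set"
    and F :: "real ^ 'n \<Rightarrow> (real ^ 'm) set"
    and ybar :: "real ^ 'm"
  assumes closed_F1: "closed (gph F1)"
    and closed_F2: "closed (gph F2)"
    and F_eq: "F = F2 \<circ>\<^sub>s F1"
    and ybar: "ybar \<in> jelonek_set F"
    and boundedness: "\<exists>R>0. \<exists>R'>0. \<exists>V. ybar \<in> interior V \<and>
      (\<forall>x \<in> UNIV - cball 0 R. \<forall>y \<in> V. F1 x \<inter> sv_inv F2 y \<subseteq> cball 0 R')"
    and qualification: "\<forall>z \<in> jelonek_comp_set F2 F1 ybar.
      coderivative F2 z ybar 0 \<inter> sv_ker (coderivative_at_infinity F1 z) = {0}"
  shows "locally_closed_at_infinity (gph F) ybar \<and>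
    (\<forall>v. coderivative_at_infinity (F2 \<circ>\<^sub>s F1) ybar v \<subseteq>
      (\<Union>zbar \<in> jelonek_comp_set F2 F1 ybar.
        (coderivative_at_infinity F1 zbar \<circ>\<^sub>s coderivative F2 zbar ybar) v))"
proof (intro conjI allI subsetI)
  obtain R R' V where R: "R > 0" and V: "ybar \<in> interior V"
    and sub: "\<forall>x \<in> UNIV - cball 0 R. \<forall>y \<in> V. F1 x \<inter> sv_inv F2 y \<subseteq> cball 0 R'"
    using boundedness by blast
  have bdd: "norm z \<le> R'" if "norm x > R" "y \<in> V" "(x, z) \<in> gph F1" "(z, y) \<in> gph F2" for x z y
  proof -
    have "x \<in> UNIV - cball 0 R" using that(1) by simp
    moreover have "z \<in> F1 x \<inter> sv_inv F2 y" using that(3,4) by (simp add: gph_def sv_inv_def)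
    ultimately have "z \<in> cball 0 R'" using sub that(2) by blast
    then show ?thesis by simp
  qed
  show "locally_closed_at_infinity (gph F) ybar"
    unfolding F_eq gph_sv_comp
    by (rule locally_closed_at_infinity_relcomp[OF closed_F1 closed_F2 V R]) (rule bdd)
  fix v u
  assume "u \<in> coderivative_at_infinity (F2 \<circ>\<^sub>s F1) ybar v"
  then obtain x y \<zeta> where xy: "\<And>k. (x k, y k) \<in> gph F1 O gph F2"
    and x_inf: "filterlim (\<lambda>k. norm (x k)) at_top sequentially" and y_lim: "y \<longlonglongrightarrow> ybar"
    and \<zeta>: "\<And>k::nat. \<zeta> k \<in> regular_normal_cone (gph F1 O gph F2) (x k, y k)"
    and \<zeta>_lim: "\<zeta> \<longlonglongrightarrow> (u, - v)"
    unfolding coderivative_at_infinity_def normal_cone_at_infinity_def gph_sv_comp by blast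
  have "\<forall>k. \<exists>z. (x k, z) \<in> gph F1 \<and> (z, y k) \<in> gph F2"
    using xy by blast
  then obtain z where z: "\<And>k. (x k, z k) \<in> gph F1" "\<And>k. (z k, y k) \<in> gph F2"
    by metis
  have "\<forall>\<^sub>F k in sequentially. norm (x k) > R"
    using x_inf by (simp add: filterlim_at_top_dense)
  moreover have "\<forall>\<^sub>F k in sequentially. y k \<in> interior V"
    using y_lim V by (intro topological_tendstoD) auto
  ultimately have "\<forall>\<^sub>F k in sequentially. norm (z k) \<le> R'"
    by eventually_elim (rule bdd[OF _ _ z], use interior_subset in auto)
  then obtain r z0 where r: "strict_mono r" and z_lim: "(\<lambda>k. z (r k)) \<longlonglongrightarrow> z0"
    by (rule eventually_bounded_imp_convergent_subseq)
  note sub = LIMSEQ_subseq_LIMSEQ[OF _ r, unfolded o_def]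
  have xr_inf: "filterlim (\<lambda>k. norm (x (r k))) at_top sequentially"
    by (rule filterlim_compose[OF x_inf filterlim_subseq[OF r]])
  have z0: "z0 \<in> jelonek_comp_set F2 F1 ybar"
    unfolding jelonek_comp_set_def using z xr_inf z_lim sub[OF y_lim]
    by (intro CollectI exI[of _ "\<lambda>k. x (r k)"] exI[of _ "\<lambda>k. z (r k)"] exI[of _ "\<lambda>k. y (r k)"])
       (auto simp: gph_def)
  have cq: "w = 0" if "(0, - w) \<in> normal_cone_at_infinity (gph F1) z0"
    "(w, 0) \<in> limiting_normal_cone (gph F2) (z0, ybar)" for w
  proof -
    have "w \<in> coderivative F2 z0 ybar 0 \<inter> sv_ker (coderivative_at_infinity F1 z0)"
      using that by (simp add: coderivative_def sv_ker_def coderivative_at_infinity_def)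
    then show ?thesis using qualification z0 by blast
  qed
  have "\<exists>w. (u, - w) \<in> normal_cone_at_infinity (gph F1) z0 \<and>
      (w, - v) \<in> limiting_normal_cone (gph F2) (z0, ybar)"
    by (rule normal_cone_at_infinity_relcomp[OF closed_F1 closed_F2 xr_inf z_lim sub[OF y_lim] z,
          where u = "\<lambda>k. fst (\<zeta> (r k))" and v = "\<lambda>k. snd (\<zeta> (r k))"])
       (use \<zeta> tendsto_fst[OF sub[OF \<zeta>_lim]] tendsto_snd[OF sub[OF \<zeta>_lim]] cq in auto)
  then have "u \<in> (coderivative_at_infinity F1 z0 \<circ>\<^sub>s coderivative F2 z0 ybar) v"
    by (auto simp: sv_comp_def sv_inv_def coderivative_def coderivative_at_infinity_def)
  with z0 show "u \<in> (\<Union>zbar \<in> jelonek_comp_set F2 F1 ybar.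
      (coderivative_at_infinity F1 zbar \<circ>\<^sub>s coderivative F2 zbar ybar) v)"
    by blast
qed

end
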